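(* Let $E$ be a finite set. Let $\Gamma$ be a family of vectors in $\mathbb R^E_{\ge0}$ with fixed coordinate sum $k>0$, i.e. $\sum_{e\in E}\gamma(e)=k$ for every $\gamma\in\Gamma$. Let $\sigma\in\mathbb R^E_{>0}$ be a set of weights such that $\sigma\ge\gamma$ coordinatewise for every $\gamma\in\Gamma$. Define $\Gamma^*:=\{\sigma-\gamma:\gamma\in\Gamma\}$. Let $\widehat\Gamma$ and $\widehat{\Gamma^*}$ be the Fulkerson blocker families of $\Gamma$ and $\Gamma^*$, respectively. Let $\eta^*$ and $\eta^*_\circ$ be the optimal densities for $\operatorname{Mod}_{2,\sigma^{-1}}(\widehat\Gamma)$ and $\operatorname{Mod}_{2,\sigma^{-1}}(\widehat{\Gamma^*})$, respectively. Then $$\eta^*+\eta^*_\circ=\sigma.$$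
   Context: A family of objects on $E$ is identified with a nonempty finite set of usage vectors $\Gamma\subset\mathbb R^E_{\ge0}$, none of which is zero (this applies to $\Gamma$ and to $\Gamma^*$). The admissible set is $\operatorname{Adm}(\Gamma)=\{\rho\in\mathbb R^E_{\ge0}:\sum_{e}\gamma(e)\rho(e)\ge1\ \forall\gamma\in\Gamma\}$. The Fulkerson blocker family $\widehat\Gamma$ is the set of extreme points of $\operatorname{Adm}(\Gamma)$. For weights $w\in\mathbb R^E_{>0}$, $\operatorname{Mod}_{2,w}(\Gamma)=\inf_{\rho\in\operatorname{Adm}(\Gamma)}\sum_{e\in E}w(e)\rho(e)^2$; its (unique) minimizer is called the optimal density. $\sigma^{-1}$ is the vector with coordinates $\sigma(e)^{-1}$. By Fulkerson duality $\operatorname{Adm}(\widehat\Gamma)=\operatorname{conv}(\Gamma)+\mathbb R^E_{\ge0}$. *)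

theory Defs
  imports "HOL-Analysis.Analysis"
begin

text \<open>
  The finite ground set \<open>E\<close> is the index type \<open>'e\<close>.  Empty \<open>E\<close> is excluded by the setting, since a
  usage family has a nonzero member.
\<close>

definition usage_family :: "(real ^ 'e) set \<Rightarrow> bool" where
  "usage_family \<Gamma> \<longleftrightarrow>
     finite \<Gamma> \<and> \<Gamma> \<noteq> {} \<and> (\<forall>\<gamma>\<in>\<Gamma>. (\<forall>e. 0 \<le> \<gamma> $ e) \<and> \<gamma> \<noteq> 0)"

definition Adm :: "(real ^ 'e) set \<Rightarrow> (real ^ 'e) set" where
  "Adm \<Gamma> = {\<rho>. (\<forall>e. 0 \<le> \<rho> $ e) \<and> (\<forall>\<gamma>\<in>\<Gamma>. (\<Sum>e\<in>UNIV. \<gamma> $ e * \<rho> $ e) \<ge> 1)}"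

definition blocker :: "(real ^ 'e) set \<Rightarrow> (real ^ 'e) set" where
  "blocker \<Gamma> = {\<rho>. \<rho> extreme_point_of Adm \<Gamma>}"

definition energy2 :: "real ^ 'e \<Rightarrow> real ^ 'e \<Rightarrow> real" where
  "energy2 w \<rho> = (\<Sum>e\<in>UNIV. w $ e * (\<rho> $ e)\<^sup>2)"

definition Mod2 :: "real ^ 'e \<Rightarrow> (real ^ 'e) set \<Rightarrow> real" where
  "Mod2 w \<Gamma> = (INF \<rho>\<in>Adm \<Gamma>. energy2 w \<rho>)"

definition is_optimal_density :: "real ^ 'e \<Rightarrow> (real ^ 'e) set \<Rightarrow> real ^ 'e \<Rightarrow> bool" where
  "is_optimal_density w \<Gamma> \<rho> \<longleftrightarrow> \<rho> \<in> Adm \<Gamma> \<and> energy2 w \<rho> = Mod2 w \<Gamma>"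

text \<open>
  The description is proper for positive weights and nonempty \<open>Adm \<Gamma>\<close>, see \<open>ex1_optimal_density\<close>.
\<close>

definition optimal_density :: "real ^ 'e \<Rightarrow> (real ^ 'e) set \<Rightarrow> real ^ 'e" where
  "optimal_density w \<Gamma> = (THE \<rho>. is_optimal_density w \<Gamma> \<rho>)"

lemma Adm_nonempty:
  fixes \<Gamma> :: "(real ^ 'e) set"
  assumes fin: "finite \<Gamma>" and nz: "\<forall>\<gamma>\<in>\<Gamma>. (\<forall>e. 0 \<le> \<gamma> $ e) \<and> \<gamma> \<noteq> 0"
  shows "Adm \<Gamma> \<noteq> {}"
proof -
  define s where "s \<gamma> = (\<Sum>e\<in>UNIV. \<gamma> $ e)" for \<gamma> :: "real ^ 'e"
  have pos: "s \<gamma> > 0" if "\<gamma> \<in> \<Gamma>" for \<gamma>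
  proof -
    obtain e where "\<gamma> $ e \<noteq> 0" using nz \<open>\<gamma> \<in> \<Gamma>\<close> by (auto simp: vec_eq_iff)
    then show ?thesis unfolding s_def using nz \<open>\<gamma> \<in> \<Gamma>\<close>
      by (intro sum_pos2[of _ e]) (simp_all add: order.not_eq_order_implies_strict)
  qed
  define c where "c = (\<Sum>\<gamma>\<in>\<Gamma>. 1 / s \<gamma>)"
  have c0: "c \<ge> 0" unfolding c_def by (intro sum_nonneg) (simp add: order.strict_implies_order[OF pos])
  have "(\<chi> e. c) \<in> Adm \<Gamma>"
  proof -
    have "(\<Sum>e\<in>UNIV. \<gamma> $ e * c) \<ge> 1" if "\<gamma> \<in> \<Gamma>" for \<gamma>
    proof -
      have "1 / s \<gamma> \<le> c" unfolding c_def
        by (intro member_le_sum) (use fin that in \<open>auto intro: order.strict_implies_order pos\<close>)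
      then have "1 \<le> s \<gamma> * c" using pos[OF that] by (simp add: field_simps)
      then show ?thesis by (simp add: s_def sum_distrib_right)
    qed
    then show ?thesis using c0 by (simp add: Adm_def)
  qed
  then show ?thesis by blast
qed

lemma closed_convex_Adm:
  fixes \<Gamma> :: "(real ^ 'e) set"
  shows "closed (Adm \<Gamma>)" "convex (Adm \<Gamma>)"
proof -
  have eq: "Adm \<Gamma> = (\<Inter>e. {\<rho>. axis e 1 \<bullet> \<rho> \<ge> 0}) \<inter> (\<Inter>\<gamma>\<in>\<Gamma>. {\<rho>. \<gamma> \<bullet> \<rho> \<ge> 1})"
    by (simp add: Adm_def inner_axis' set_eq_iff) (simp add: inner_vec_def)
  show "closed (Adm \<Gamma>)" unfolding eq
    by (intro closed_Int closed_INT ballI closed_halfspace_ge)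
  show "convex (Adm \<Gamma>)" unfolding eq
    by (intro convex_Int convex_INT convex_halfspace_ge)
qed

lemma ex1_optimal_density:
  fixes \<Gamma> :: "(real ^ 'e) set"
  assumes ne: "Adm \<Gamma> \<noteq> {}" and w: "\<forall>e. w $ e > 0"
  shows "\<exists>!\<rho>. is_optimal_density w \<Gamma> \<rho>"
proof -
  define D where "D \<rho> = (\<chi> e. sqrt (w $ e) * \<rho> $ e)" for \<rho> :: "real ^ 'e"
  have lin: "linear D"
    by (intro linearI) (auto simp: D_def vec_eq_iff algebra_simps)
  have inj: "inj D"
  proof (rule injI)
    fix x y assume h: "D x = D y"
    have "x $ e = y $ e" for e
    proof -
      have "sqrt (w $ e) * x $ e = sqrt (w $ e) * y $ e"
        using arg_cong[OF h, of "\<lambda>v. v $ e"] by (simp add: D_def)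
      then show ?thesis using w[rule_format, of e] by simp
    qed
    then show "x = y" by (simp add: vec_eq_iff)
  qed
  have energy: "energy2 w \<rho> = (norm (D \<rho>))\<^sup>2" for \<rho>
  proof -
    have "sqrt (w $ e) * \<rho> $ e * (sqrt (w $ e) * \<rho> $ e) = w $ e * (\<rho> $ e)\<^sup>2" for e
    proof -
      have "(sqrt (w $ e) * \<rho> $ e)\<^sup>2 = w $ e * (\<rho> $ e)\<^sup>2"
        using w by (simp add: power_mult_distrib less_imp_le)
      then show ?thesis by (simp only: power2_eq_square)
    qed
    then show ?thesis
      by (simp add: energy2_def D_def power2_norm_eq_inner inner_vec_def)
  qed
  have opt: "is_optimal_density w \<Gamma> \<rho> \<longleftrightarrow>
      \<rho> \<in> Adm \<Gamma> \<and> (\<forall>\<rho>'\<in>Adm \<Gamma>. dist 0 (D \<rho>) \<le> dist 0 (D \<rho>'))" for \<rho>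
  proof -
    have bdd: "bdd_below (energy2 w ` Adm \<Gamma>)"
      by (intro bdd_belowI[of _ 0]) (auto simp: energy)
    have "energy2 w \<rho> = Mod2 w \<Gamma> \<longleftrightarrow> (\<forall>\<rho>'\<in>Adm \<Gamma>. energy2 w \<rho> \<le> energy2 w \<rho>')"
      if "\<rho> \<in> Adm \<Gamma>"
    proof
      assume "energy2 w \<rho> = Mod2 w \<Gamma>"
      then show "\<forall>\<rho>'\<in>Adm \<Gamma>. energy2 w \<rho> \<le> energy2 w \<rho>'"
        using bdd by (auto simp: Mod2_def intro: cINF_lower)
    next
      assume "\<forall>\<rho>'\<in>Adm \<Gamma>. energy2 w \<rho> \<le> energy2 w \<rho>'"
      then show "energy2 w \<rho> = Mod2 w \<Gamma>" unfolding Mod2_def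
        using bdd ne that by (intro antisym cINF_greatest cINF_lower) auto
    qed
    then show ?thesis
      by (auto simp: is_optimal_density_def energy)
  qed
  have cl: "closed (D ` Adm \<Gamma>)"
    using closed_injective_linear_image[OF closed_convex_Adm(1) lin inj] .
  have cv: "convex (D ` Adm \<Gamma>)"
    using convex_linear_image[OF lin closed_convex_Adm(2)] .
  have "D ` Adm \<Gamma> \<noteq> {}"
    using ne by simp
  from closest_point_exists[OF cl this, of 0]
  have "\<exists>\<rho>. is_optimal_density w \<Gamma> \<rho>" unfolding opt by auto
  moreover have "\<rho> = \<rho>'" if "is_optimal_density w \<Gamma> \<rho>" "is_optimal_density w \<Gamma> \<rho>'" for \<rho> \<rho>'
  proof -
    have "D \<rho> = D \<rho>'"
      using that unfolding opt by (intro any_closest_point_unique[OF cv cl, of _ _ 0]) auto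
    then show ?thesis using inj by (simp add: inj_eq)
  qed
  ultimately show ?thesis by blast
qed

end

theory Submission
  imports Defs
begin

text \<open>
  By Fulkerson duality every density admissible for \<open>blocker \<Gamma>\<close> dominates a point of
  \<open>convex hull \<Gamma>\<close>, and every point of the hull is admissible
  (\<open>Adm_blocker_iff_dominates_hull\<close>).  The energy is monotone on nonnegative vectors, so the
  optimal density is the energy minimizer over \<open>convex hull \<Gamma>\<close>
  (\<open>optimal_density_blocker_eqI\<close>).

  The reflection \<open>\<xi> \<mapsto> \<sigma> - \<xi>\<close> maps the hull of \<open>\<Gamma>\<close> onto the hull of
  \<open>\<Gamma>_star\<close>.  With weights \<open>1 / \<sigma>\<close> the cross term in the expansion of
  \<open>(\<sigma> e - \<xi> e)\<^sup>2 / \<sigma> e\<close> is \<open>- 2 * \<xi> e\<close>, whose sum over \<open>e\<close> is the constant \<open>- 2 * k\<close>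
  on the hull.  Hence the reflection changes the energy only by an additive constant
  (\<open>energy2_reflection\<close>) and carries the minimizer of one hull to the minimizer of the other.
\<close>

lemma Adm_iff_inner: "\<rho> \<in> Adm \<Gamma> \<longleftrightarrow> (\<forall>e. 0 \<le> \<rho> $ e) \<and> (\<forall>\<gamma>\<in>\<Gamma>. 1 \<le> \<gamma> \<bullet> \<rho>)"
  by (simp add: Adm_def inner_vec_def)

lemma inner_nonneg_vec:
  fixes x y :: "real ^ 'e"
  assumes "\<And>e. 0 \<le> x $ e" "\<And>e. 0 \<le> y $ e"
  shows "0 \<le> x \<bullet> y"
  using assms by (simp add: inner_vec_def sum_nonneg)

lemma inner_mono_vec:
  fixes x y z :: "real ^ 'e"
  assumes "\<And>e. 0 \<le> z $ e" "\<And>e. x $ e \<le> y $ e"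
  shows "x \<bullet> z \<le> y \<bullet> z"
  using assms by (simp add: inner_vec_def sum_mono mult_right_mono)

text \<open>
  A strictly positive functional has compact sublevel sets on the nonnegative orthant.  So it
  attains its minimum over \<open>Adm \<Gamma>\<close>, on a compact face, and an extreme point of that face is
  an extreme point of \<open>Adm \<Gamma>\<close>.
\<close>

lemma positive_functional_improved_in_blocker:
  fixes \<Gamma> :: "(real ^ 'e) set"
  assumes pos: "\<And>e. 0 < \<eta> $ e" and \<rho>: "\<rho> \<in> Adm \<Gamma>"
  obtains v where "v \<in> blocker \<Gamma>" "\<eta> \<bullet> v \<le> \<eta> \<bullet> \<rho>"
proof -
  define S where "S = Adm \<Gamma> \<inter> {x. \<eta> \<bullet> x \<le> \<eta> \<bullet> \<rho>}"
  have coord: "x $ e \<le> (\<eta> \<bullet> \<rho>) / \<eta> $ e" if "x \<in> S" for x e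
  proof -
    have nn: "0 \<le> x $ i" for i
      using that by (auto simp: S_def Adm_iff_inner)
    have "\<eta> $ e * x $ e \<le> (\<Sum>i\<in>UNIV. \<eta> $ i * x $ i)"
      by (intro member_le_sum mult_nonneg_nonneg less_imp_le[OF pos] nn) auto
    also have "\<dots> \<le> \<eta> \<bullet> \<rho>"
      using that by (simp add: S_def inner_vec_def)
    finally show ?thesis
      using pos[of e] by (simp add: field_simps)
  qed
  have "bounded S"
  proof (rule bounded_subset)
    show "S \<subseteq> cbox 0 (\<chi> e. (\<eta> \<bullet> \<rho>) / \<eta> $ e)"
      using coord by (auto simp: mem_box_cart S_def Adm_iff_inner)
  qed simp
  moreover have "closed S"
    unfolding S_def by (intro closed_Int closed_convex_Adm closed_halfspace_le)
  ultimately have "compact S"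
    by (simp add: compact_eq_bounded_closed)
  have "\<rho> \<in> S"
    using \<rho> by (simp add: S_def)
  obtain m where m: "m \<in> S" "\<And>x. x \<in> S \<Longrightarrow> \<eta> \<bullet> m \<le> \<eta> \<bullet> x"
    using continuous_attains_inf[OF \<open>compact S\<close> _ continuous_on_inner[OF continuous_on_const continuous_on_id]]
      \<open>\<rho> \<in> S\<close> by blast
  have m_le: "\<eta> \<bullet> m \<le> \<eta> \<bullet> x" if "x \<in> Adm \<Gamma>" for x
    using m that by (cases "\<eta> \<bullet> x \<le> \<eta> \<bullet> \<rho>") (auto simp: S_def)
  define F where "F = Adm \<Gamma> \<inter> {x. \<eta> \<bullet> x = \<eta> \<bullet> m}"
  have face: "F face_of Adm \<Gamma>"
    unfolding F_def using closed_convex_Adm(2) m_le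
    by (rule face_of_Int_supporting_hyperplane_ge)
  have "F = S \<inter> {x. \<eta> \<bullet> x = \<eta> \<bullet> m}"
    using m(1) by (auto simp: F_def S_def)
  then have "compact F"
    using \<open>compact S\<close> by (simp add: compact_Int_closed closed_hyperplane)
  moreover have "F \<noteq> {}"
    using m(1) by (auto simp: F_def S_def)
  moreover have "convex F"
    using face by (rule face_of_imp_convex)
  ultimately obtain v where v: "v extreme_point_of F"
    using extreme_point_exists_convex by blast
  then have "v \<in> F" "v extreme_point_of Adm \<Gamma>"
    using extreme_point_of_face[OF face] by auto
  moreover have "\<eta> \<bullet> m \<le> \<eta> \<bullet> \<rho>"
    using m_le \<rho> by blast
  ultimately show thesis
    using that by (auto simp: blocker_def F_def)
qed

text \<open>
  Only strict violations have to be transferred to extreme points, which allows for zero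
  coordinates of \<open>\<eta>\<close>: a small multiple of the all-ones vector is added to \<open>\<eta>\<close>.
\<close>

lemma Adm_blocker_inner_ge:
  fixes \<Gamma> :: "(real ^ 'e) set"
  assumes \<eta>: "\<eta> \<in> Adm (blocker \<Gamma>)" and \<rho>: "\<rho> \<in> Adm \<Gamma>"
  shows "1 \<le> \<eta> \<bullet> \<rho>"
proof (rule ccontr)
  assume neg: "\<not> 1 \<le> \<eta> \<bullet> \<rho>"
  have \<eta>0: "0 \<le> \<eta> $ e" for e
    using \<eta> by (simp add: Adm_iff_inner)
  have ones: "0 \<le> 1 \<bullet> x" if "x \<in> Adm \<Gamma>" for x :: "real ^ 'e"
    using that by (intro inner_nonneg_vec) (auto simp: Adm_iff_inner)
  \<comment> \<open>The choice of \<open>\<epsilon>\<close> keeps the perturbed value at \<open>\<rho>\<close> below 1.\<close>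
  define \<epsilon> where "\<epsilon> = (1 - \<eta> \<bullet> \<rho>) / (1 + 1 \<bullet> \<rho>)"
  have \<epsilon>: "\<epsilon> > 0"
    using neg ones[OF \<rho>] by (simp add: \<epsilon>_def)
  have "\<epsilon> * (1 + 1 \<bullet> \<rho>) = 1 - \<eta> \<bullet> \<rho>"
    using ones[OF \<rho>] by (simp add: \<epsilon>_def)
  then have less: "(\<eta> + \<epsilon> *\<^sub>R 1) \<bullet> \<rho> < 1"
    using \<epsilon> by (simp add: inner_add_left algebra_simps)
  have "0 < (\<eta> + \<epsilon> *\<^sub>R 1) $ e" for e
    using \<eta>0[of e] \<epsilon> by simp
  then obtain v where v: "v \<in> blocker \<Gamma>" "(\<eta> + \<epsilon> *\<^sub>R 1) \<bullet> v \<le> (\<eta> + \<epsilon> *\<^sub>R 1) \<bullet> \<rho>"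
    using positive_functional_improved_in_blocker \<rho> by blast
  have "v \<in> Adm \<Gamma>"
    using v(1) by (simp add: blocker_def extreme_point_of_def)
  then have "\<eta> \<bullet> v \<le> (\<eta> + \<epsilon> *\<^sub>R 1) \<bullet> v"
    using ones \<epsilon> by (simp add: inner_add_left)
  moreover have "1 \<le> v \<bullet> \<eta>"
    using \<eta> v(1) by (simp add: Adm_iff_inner)
  ultimately show False
    using v(2) less by (simp add: inner_commute)
qed

lemma convex_hull_nonneg:
  assumes "usage_family \<Gamma>" "\<xi> \<in> convex hull \<Gamma>"
  shows "0 \<le> \<xi> $ e"
proof -
  have "convex hull \<Gamma> \<subseteq> {x. axis e 1 \<bullet> x \<ge> 0}"
    using assms(1)
    by (intro hull_minimal convex_halfspace_ge) (auto simp: usage_family_def inner_axis')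
  then show ?thesis
    using assms(2) by (auto simp: inner_axis')
qed

lemma convex_hull_subset_Adm_blocker:
  assumes "usage_family \<Gamma>"
  shows "convex hull \<Gamma> \<subseteq> Adm (blocker \<Gamma>)"
proof (rule hull_minimal)
  have "1 \<le> v \<bullet> \<gamma>" if "\<gamma> \<in> \<Gamma>" "v \<in> blocker \<Gamma>" for \<gamma> v
    using that inner_commute[of v \<gamma>] by (auto simp: blocker_def extreme_point_of_def Adm_iff_inner)
  then show "\<Gamma> \<subseteq> Adm (blocker \<Gamma>)"
    using assms by (auto simp: Adm_iff_inner usage_family_def)
qed (rule closed_convex_Adm(2))

text \<open>
  If \<open>\<eta>\<close> dominated no point of the hull, a hyperplane would separate the compact hull from the
  closed orthant of vectors below \<open>\<eta>\<close>.  Its normal is nonnegative because that orthant is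
  unbounded downwards, and after rescaling it is an admissible density \<open>\<rho>\<close> with
  \<open>\<eta> \<bullet> \<rho> < 1\<close>.
\<close>

lemma Adm_blocker_dominates_hull:
  fixes \<Gamma> :: "(real ^ 'e) set"
  assumes \<Gamma>: "usage_family \<Gamma>" and \<eta>: "\<eta> \<in> Adm (blocker \<Gamma>)"
  obtains \<xi> where "\<xi> \<in> convex hull \<Gamma>" "\<And>e. \<xi> $ e \<le> \<eta> $ e"
proof (rule ccontr)
  assume "\<not> thesis"
  define L where "L = {x. \<forall>e. x $ e \<le> \<eta> $ e}"
  have L_eq: "L = (\<Inter>e. {x. axis e 1 \<bullet> x \<le> \<eta> $ e})"
    by (auto simp: L_def inner_axis')
  have "closed L" "convex L"
    unfolding L_eq by (auto intro!: closed_INT convex_INT closed_halfspace_le convex_halfspace_le)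
  moreover have "L \<inter> convex hull \<Gamma> = {}"
    using \<open>\<not> thesis\<close> that by (auto simp: L_def)
  moreover have "compact (convex hull \<Gamma>)" "convex hull \<Gamma> \<noteq> {}"
    using \<Gamma> by (auto simp: usage_family_def finite_imp_compact_convex_hull)
  ultimately obtain a b where below: "\<And>x. x \<in> L \<Longrightarrow> a \<bullet> x < b"
    and above: "\<And>x. x \<in> convex hull \<Gamma> \<Longrightarrow> a \<bullet> x > b"
    using separating_hyperplane_closed_compact[of L "convex hull \<Gamma>"] convex_convex_hull by metis
  have "\<eta> \<in> L"
    by (simp add: L_def)
  have a0: "0 \<le> a $ e" for e
  proof (rule ccontr)
    assume neg: "\<not> 0 \<le> a $ e"
    \<comment> \<open>Moving from \<open>\<eta>\<close> by \<open>t\<close> down the axis \<open>e\<close> makes the functional reach the value \<open>b\<close>.\<close>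
    define t where "t = (b - a \<bullet> \<eta>) / (- a $ e)"
    have "t > 0"
      using neg below[OF \<open>\<eta> \<in> L\<close>] unfolding t_def by (intro divide_pos_pos) auto
    then have "\<eta> - t *\<^sub>R axis e 1 \<in> L"
      by (auto simp: L_def axis_def)
    from below[OF this] have "a \<bullet> \<eta> - t * a $ e < b"
      by (simp add: inner_diff_right inner_axis)
    moreover have "t * a $ e = a \<bullet> \<eta> - b"
      using neg by (simp add: t_def field_simps)
    ultimately show False
      by simp
  qed
  have "0 \<le> a \<bullet> \<eta>"
    using \<eta> by (intro inner_nonneg_vec a0) (simp add: Adm_iff_inner)
  then have b: "0 < b"
    using below[OF \<open>\<eta> \<in> L\<close>] by simp
  have "(1 / b) *\<^sub>R a \<in> Adm \<Gamma>"
    using a0 b above[OF hull_inc] less_imp_le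
    by (fastforce simp: Adm_iff_inner inner_commute)
  from Adm_blocker_inner_ge[OF \<eta> this] have "b \<le> a \<bullet> \<eta>"
    using b by (simp add: inner_commute field_simps)
  then show False
    using below[OF \<open>\<eta> \<in> L\<close>] by simp
qed

lemma Adm_blocker_iff_dominates_hull:
  fixes \<Gamma> :: "(real ^ 'e) set"
  assumes "usage_family \<Gamma>"
  shows "\<eta> \<in> Adm (blocker \<Gamma>) \<longleftrightarrow> (\<exists>\<xi>\<in>convex hull \<Gamma>. \<forall>e. \<xi> $ e \<le> \<eta> $ e)"
proof
  assume "\<eta> \<in> Adm (blocker \<Gamma>)"
  then show "\<exists>\<xi>\<in>convex hull \<Gamma>. \<forall>e. \<xi> $ e \<le> \<eta> $ e"
    using Adm_blocker_dominates_hull[OF assms] by metis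
next
  assume "\<exists>\<xi>\<in>convex hull \<Gamma>. \<forall>e. \<xi> $ e \<le> \<eta> $ e"
  then obtain \<xi> where \<xi>: "\<xi> \<in> convex hull \<Gamma>" "\<And>e. \<xi> $ e \<le> \<eta> $ e"
    by blast
  have "0 \<le> \<eta> $ e" for e
    using convex_hull_nonneg[OF assms \<xi>(1)] \<xi>(2) order_trans by blast
  moreover have "1 \<le> v \<bullet> \<eta>" if "v \<in> blocker \<Gamma>" for v
  proof -
    have "v \<in> Adm \<Gamma>"
      using that by (simp add: blocker_def extreme_point_of_def)
    then have "\<xi> \<bullet> v \<le> \<eta> \<bullet> v"
      by (intro inner_mono_vec \<xi>(2)) (simp add: Adm_iff_inner)
    moreover have "1 \<le> v \<bullet> \<xi>"
      using convex_hull_subset_Adm_blocker[OF assms] \<xi>(1) that by (auto simp: Adm_iff_inner)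
    ultimately show ?thesis
      by (simp add: inner_commute)
  qed
  ultimately show "\<eta> \<in> Adm (blocker \<Gamma>)"
    by (simp add: Adm_iff_inner)
qed

lemma energy2_mono:
  assumes "\<And>e. 0 \<le> w $ e" "\<And>e. 0 \<le> \<xi> $ e" "\<And>e. \<xi> $ e \<le> \<eta> $ e"
  shows "energy2 w \<xi> \<le> energy2 w \<eta>"
  unfolding energy2_def using assms by (intro sum_mono mult_left_mono power_mono) auto

lemma optimal_density_eqI:
  fixes \<Gamma> :: "(real ^ 'e) set"
  assumes w: "\<And>e. 0 < w $ e" and \<eta>: "\<eta> \<in> Adm \<Gamma>"
    and min: "\<And>\<rho>. \<rho> \<in> Adm \<Gamma> \<Longrightarrow> energy2 w \<eta> \<le> energy2 w \<rho>"
  shows "optimal_density w \<Gamma> = \<eta>"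
proof -
  have "Mod2 w \<Gamma> = energy2 w \<eta>"
    unfolding Mod2_def using \<eta> min by (intro cInf_eq_minimum) auto
  then have "is_optimal_density w \<Gamma> \<eta>"
    using \<eta> by (simp add: is_optimal_density_def)
  moreover have "\<exists>!\<rho>. is_optimal_density w \<Gamma> \<rho>"
    using \<eta> w by (intro ex1_optimal_density) auto
  ultimately show ?thesis
    unfolding optimal_density_def by (simp add: the1_equality)
qed

text \<open>
  Every admissible vector dominates a nonnegative vector of the hull, whose energy is no larger.
\<close>

lemma optimal_density_blocker_eqI:
  fixes \<Gamma> :: "(real ^ 'e) set"
  assumes \<Gamma>: "usage_family \<Gamma>" and w: "\<And>e. 0 < w $ e" and \<eta>: "\<eta> \<in> convex hull \<Gamma>"
    and min: "\<And>\<xi>. \<xi> \<in> convex hull \<Gamma> \<Longrightarrow> energy2 w \<eta> \<le> energy2 w \<xi>"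
  shows "optimal_density w (blocker \<Gamma>) = \<eta>"
proof (rule optimal_density_eqI[OF w])
  show "\<eta> \<in> Adm (blocker \<Gamma>)"
    using convex_hull_subset_Adm_blocker[OF \<Gamma>] \<eta> by blast
next
  fix \<rho> assume "\<rho> \<in> Adm (blocker \<Gamma>)"
  then obtain \<xi> where \<xi>: "\<xi> \<in> convex hull \<Gamma>" "\<And>e. \<xi> $ e \<le> \<rho> $ e"
    using Adm_blocker_iff_dominates_hull[OF \<Gamma>] by blast
  have "energy2 w \<xi> \<le> energy2 w \<rho>"
    by (intro energy2_mono less_imp_le[OF w] convex_hull_nonneg[OF \<Gamma> \<xi>(1)] \<xi>(2))
  then show "energy2 w \<eta> \<le> energy2 w \<rho>"
    using min[OF \<xi>(1)] by simp
qed

lemma energy2_reflection: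
  fixes \<sigma> \<xi> :: "real ^ 'e"
  assumes "\<And>e. \<sigma> $ e \<noteq> 0"
  shows "energy2 (\<chi> e. inverse (\<sigma> $ e)) (\<sigma> - \<xi>) =
    energy2 (\<chi> e. inverse (\<sigma> $ e)) \<xi> + (\<Sum>e\<in>UNIV. \<sigma> $ e) - 2 * (\<Sum>e\<in>UNIV. \<xi> $ e)"
proof -
  have "inverse (\<sigma> $ e) * ((\<sigma> - \<xi>) $ e)\<^sup>2
      = inverse (\<sigma> $ e) * (\<xi> $ e)\<^sup>2 + \<sigma> $ e - 2 * \<xi> $ e" for e
    using assms[of e] by (simp add: field_simps power2_eq_square)
  then show ?thesis
    by (simp add: energy2_def sum.distrib sum_subtractf sum_distrib_left)
qed

lemma convex_hull_reflection:
  fixes S :: "'a::real_vector set"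
  shows "convex hull ((\<lambda>x. a - x) ` S) = (\<lambda>x. a - x) ` (convex hull S)"
  using convex_hull_affinity[of a "-1" S] by simp

theorem theorem6p8:
  fixes \<Gamma> \<Gamma>_star :: "(real ^ 'e) set" and \<sigma> :: "real ^ 'e" and k :: real
  assumes "usage_family \<Gamma>"
    and "k > 0"
    and "\<forall>\<gamma>\<in>\<Gamma>. (\<Sum>e\<in>UNIV. \<gamma> $ e) = k"
    and "\<forall>e. \<sigma> $ e > 0"
    and "\<forall>\<gamma>\<in>\<Gamma>. \<forall>e. \<gamma> $ e \<le> \<sigma> $ e"
    and "\<Gamma>_star = {\<sigma> - \<gamma> | \<gamma>. \<gamma> \<in> \<Gamma>}"
    and "usage_family \<Gamma>_star"
  shows "optimal_density (\<chi> e. inverse (\<sigma> $ e)) (blocker \<Gamma>) +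
         optimal_density (\<chi> e. inverse (\<sigma> $ e)) (blocker \<Gamma>_star) = \<sigma>"
proof -
  define w where "w = (\<chi> e. inverse (\<sigma> $ e))"
  have w: "0 < w $ e" for e
    using assms(4) by (simp add: w_def)
  have hull_star: "convex hull \<Gamma>_star = (\<lambda>x. \<sigma> - x) ` (convex hull \<Gamma>)"
    using assms(6) by (simp add: convex_hull_reflection Setcompr_eq_image)
  have "convex hull \<Gamma> \<subseteq> {x. 1 \<bullet> x = k}"
    using assms(3) by (intro hull_minimal convex_hyperplane) (auto simp: inner_vec_def)
  then have sum_k: "(\<Sum>e\<in>UNIV. \<xi> $ e) = k" if "\<xi> \<in> convex hull \<Gamma>" for \<xi>
    using that by (auto simp: inner_vec_def)
  have energy: "energy2 w (\<sigma> - \<xi>) = energy2 w \<xi> + (\<Sum>e\<in>UNIV. \<sigma> $ e) - 2 * k"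
    if "\<xi> \<in> convex hull \<Gamma>" for \<xi>
    unfolding w_def sum_k[OF that, symmetric]
    using assms(4) by (intro energy2_reflection) (simp add: less_imp_neq[THEN not_sym])
  have "compact (convex hull \<Gamma>)" "convex hull \<Gamma> \<noteq> {}"
    using assms(1) by (auto simp: usage_family_def finite_imp_compact_convex_hull)
  moreover have "continuous_on (convex hull \<Gamma>) (energy2 w)"
    unfolding energy2_def by (intro continuous_intros)
  ultimately obtain \<eta> where \<eta>: "\<eta> \<in> convex hull \<Gamma>"
    and min: "\<And>\<xi>. \<xi> \<in> convex hull \<Gamma> \<Longrightarrow> energy2 w \<eta> \<le> energy2 w \<xi>"
    using continuous_attains_inf by metis
  have "optimal_density w (blocker \<Gamma>) = \<eta>"
    using assms(1) w \<eta> min by (rule optimal_density_blocker_eqI)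
  moreover have "optimal_density w (blocker \<Gamma>_star) = \<sigma> - \<eta>"
    using assms(7) w
  proof (rule optimal_density_blocker_eqI)
    show "\<sigma> - \<eta> \<in> convex hull \<Gamma>_star"
      using \<eta> hull_star by blast
  next
    fix \<nu> assume "\<nu> \<in> convex hull \<Gamma>_star"
    then obtain \<xi> where "\<xi> \<in> convex hull \<Gamma>" "\<nu> = \<sigma> - \<xi>"
      using hull_star by blast
    then show "energy2 w (\<sigma> - \<eta>) \<le> energy2 w \<nu>"
      using energy \<eta> min by simp
  qed
  ultimately show ?thesis
    by (simp add: w_def)
qed

end
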